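(* Let $d \geq 1$ and $\Delta$ be integers with $\Delta \geq 10d$. Every $d$-degenerate graph $G$ with maximum degree at most $\Delta$ is equitably tree-$k$-colorable for every integer $k \geq (\Delta+1)/2$.
   Context: All graphs are finite and simple. A graph $G$ is $d$-degenerate if every subgraph of $G$ has a vertex of degree at most $d$. An equitable tree-$k$-coloring of $G$ is a function $c: V(G) \to \{1,2,\ldots,k\}$ such that for every $1 \le i \le k$ the set $c^{-1}(i)$ induces a forest (acyclic subgraph) in $G$, and $\big||c^{-1}(i)| - |c^{-1}(j)|\big| \le 1$ for all $1 \le i < j \le k$. $G$ is equitably tree-$k$-colorable if it admits an equitable tree-$k$-coloring. *)

theory Defs
  imports Complex_Main "Graph_Theory.Graph_Theory"
begin

text \<open>
  A finite simple graph is a member of the locale \<^locale>\<open>graph\<close>: a finite symmetric digraph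
  without loops and parallel arcs, where each edge is a pair of opposite arcs. The degree of a
  vertex is then its \<^const>\<open>out_degree\<close>, as the following lemma makes explicit.
\<close>

lemma (in graph) out_degree_eq_card_neighbours:
  "out_degree G v = card {w. v \<rightarrow>\<^bsub>G\<^esub> w}"
proof -
  have "inj_on (head G) (out_arcs G v)"
    by (rule inj_onI) (auto intro!: no_multi_arcs simp: arc_to_ends_def)
  moreover have "head G ` out_arcs G v = {w. v \<rightarrow>\<^bsub>G\<^esub> w}"
    by (auto simp: arcs_ends_conv)
  ultimately show ?thesis
    unfolding out_degree_def by (metis card_image)
qed

text \<open>The inserted 0 is the value for the graph without vertices; it changes nothing otherwise.\<close>

definition max_degree :: "('a, 'b) pre_digraph \<Rightarrow> nat" where
  "max_degree G = Max (insert 0 (out_degree G ` verts G))"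

text \<open>
  The predicate \<^const>\<open>subgraph\<close> also admits sub-digraphs that keep only one of the two arcs of an
  edge, so \<^term>\<open>graph H\<close> is required as well. As usual, subgraphs are understood to have at
  least one vertex.
\<close>

definition degenerate :: "nat \<Rightarrow> ('a, 'b) pre_digraph \<Rightarrow> bool" where
  "degenerate d G \<longleftrightarrow>
     (\<forall>H. subgraph H G \<and> graph H \<and> verts H \<noteq> {} \<longrightarrow> (\<exists>v\<in>verts H. out_degree H v \<le> d))"

text \<open>
  The library's \<^const>\<open>forest\<close> excludes directed cycles, and in a symmetric digraph every edge
  traversed back and forth is a directed cycle of length 2. The cycles of a simple graph are the
  directed cycles of length at least 3.
\<close>

definition acyclic_graph :: "('a, 'b) pre_digraph \<Rightarrow> bool" where
  "acyclic_graph G \<longleftrightarrow> \<not> (\<exists>p. pre_digraph.cycle G p \<and> 3 \<le> length p)"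

definition colour_class :: "('a, 'b) pre_digraph \<Rightarrow> ('a \<Rightarrow> nat) \<Rightarrow> nat \<Rightarrow> 'a set" where
  "colour_class G c i = {v \<in> verts G. c v = i}"

definition equitable_tree_colouring ::
    "('a, 'b) pre_digraph \<Rightarrow> nat \<Rightarrow> ('a \<Rightarrow> nat) \<Rightarrow> bool" where
  "equitable_tree_colouring G k c \<longleftrightarrow>
     (\<forall>v\<in>verts G. c v \<in> {1..k}) \<and>
     (\<forall>i\<in>{1..k}. acyclic_graph (G \<restriction> colour_class G c i)) \<and>
     (\<forall>i j. 1 \<le> i \<and> i < j \<and> j \<le> k \<longrightarrow>
        \<bar>int (card (colour_class G c i)) - int (card (colour_class G c j))\<bar> \<le> 1)"

definition equitably_tree_colourable :: "('a, 'b) pre_digraph \<Rightarrow> nat \<Rightarrow> bool" where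
  "equitably_tree_colourable G k \<longleftrightarrow> (\<exists>c. equitable_tree_colouring G k c)"

end

theory Submission
  imports Defs "HOL-Library.Transitive_Closure_Table"
begin

text \<open>
  A set \<open>H\<close> of vertices of largest degree is coloured first, by induction, with exactly \<open>\<eta>\<close> vertices of
  each colour, where \<open>\<eta>\<close> is between a sixth and a third of the class size \<open>t\<close>. This colouring of \<open>H\<close>
  is kept. The other vertices are added one at a time; a new vertex is put into a class where it has
  at most one neighbour, and vertices outside \<open>H\<close> are shifted along a path of classes until a class
  that is not yet full takes up the surplus.

  Suppose that no such path exists, and let \<open>a\<close> be the number of classes from which a class that is
  not full can be reached. Every vertex outside \<open>H\<close> in the other \<open>k - a\<close> classes has two
  neighbours in each of these \<open>a\<close> classes. By degeneracy this forces \<open>a < k / 8\<close>, and then the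
  vertices of the \<open>a\<close> classes have average degree close to \<open>2 * k\<close>. This is too much: each class
  contains only \<open>\<eta>\<close> vertices of \<open>H\<close>, and the degrees outside \<open>H\<close> are small because every vertex
  of \<open>H\<close> has at least that degree while the sum of all degrees is bounded.
\<close>

section \<open>The counting inequality\<close>

text \<open>The numerical core of the stuck case, over the reals. Here \<open>t\<close> is the cap
  on class sizes, \<open>a\<close> the number of accessible classes, \<open>h\<close> a bound on the
  degrees of the movable vertices, \<open>S\<close> the degree sum of the kept vertices in
  accessible classes, and \<open>E\<close> the number of edges between accessible classes and
  movable vertices of the other classes. If \<open>h \<le> 2 * d\<close>, then \<open>lower\<close>
  and \<open>upper\<close> already conflict. Otherwise \<open>tradeoff\<close> bounds
  \<open>h\<close>, next \<open>lower\<close> and \<open>sparse\<close> force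
  \<open>8 * a < k\<close>, and then \<open>h\<close> and \<open>S\<close> are eliminated.\<close>

lemma counting_contradiction:
  fixes d k a \<eta> t h S E :: real
  assumes pos: "0 < d" "0 < a" "0 < \<eta>" and kd: "5 * d \<le> k"
    and t: "3 * \<eta> \<le> t" "t \<le> 6 * \<eta>"
    and lower: "2 * a * ((k - a) * (t - \<eta>)) \<le> E"
    and sparse: "E \<le> d * (a * t + (k - a) * (t - \<eta>))"
    and upper: "E \<le> S + a * (t - \<eta>) * h"
    and S: "a * \<eta> * h \<le> S" "S \<le> 2 * k * (a * \<eta>)"
    and h: "2 * a \<le> h"
    and tradeoff: "2 * d < h \<Longrightarrow> S + (k - a) * \<eta> * h \<le> d * k * (t + \<eta>)"
  shows False
proof -
  define s where "s = t - \<eta>"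
  have s: "2 * \<eta> \<le> s" "s \<le> 5 * \<eta>" "0 < s" and ts: "t = s + \<eta>"
    using t pos by (auto simp: s_def)
  have k: "0 < k" using kd pos by linarith
  show False
  proof (cases "h \<le> 2 * d")
    case True
    have "a * s * h \<le> a * s * (2 * d)"
      using True pos s by (intro mult_left_mono) auto
    then have "2 * a * ((k - a) * s) \<le> 2 * k * (a * \<eta>) + a * s * (2 * d)"
      using lower upper S(2) unfolding s_def by linarith
    then have "a * (2 * ((k - a) * s)) \<le> a * (2 * k * \<eta> + s * (2 * d))"
      by (simp add: algebra_simps)
    then have "2 * ((k - a) * s) \<le> 2 * k * \<eta> + s * (2 * d)"
      using pos by simp
    then have *: "(k - a - d) * s \<le> k * \<eta>"
      by (simp add: algebra_simps)
    \<comment> \<open>From \<open>2 * a \<le> h \<le> 2 * d\<close> follows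
      \<open>a \<le> d\<close>. Inserting \<open>s \<ge> 2 * \<eta>\<close> then leaves
      \<open>k \<le> 4 * d\<close>.\<close>
    have kad: "0 \<le> k - a - d" using True h kd pos by linarith
    have "(k - a - d) * (2 * \<eta>) \<le> k * \<eta>"
      using * mult_left_mono[OF s(1) kad] by linarith
    then have "\<eta> * (2 * (k - a - d)) \<le> \<eta> * k" by (simp add: algebra_simps)
    then have "2 * (k - a - d) \<le> k" using pos by simp
    moreover have "a \<le> d" using True h by linarith
    ultimately show False using kd pos(1) by (simp add: algebra_simps)
  next
    case False
    then have tr: "S + (k - a) * \<eta> * h \<le> d * k * (t + \<eta>)" using tradeoff by simp
    \<comment> \<open>With \<open>S \<ge> a * \<eta> * h\<close> the terms in \<open>a\<close>
      cancel, and \<open>t \<le> 6 * \<eta>\<close> turns the result into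
      \<open>h \<le> 7 * d\<close>.\<close>
    have "k * (\<eta> * h) \<le> k * (d * (t + \<eta>))"
      using tr S(1) by (simp add: algebra_simps)
    then have "\<eta> * h \<le> d * (t + \<eta>)" using k by simp
    also have "\<dots> \<le> d * (7 * \<eta>)" using t pos by (intro mult_left_mono) auto
    finally have "\<eta> * h \<le> \<eta> * (7 * d)" by (simp add: algebra_simps)
    then have "h \<le> 7 * d" using pos by simp
    then have a7: "10 * a \<le> 7 * k" using h kd by linarith
    have a8: "8 * a < k"
    proof (rule ccontr)
      assume "\<not> 8 * a < k"
      then have ge: "k \<le> 8 * a" by simp
      \<comment> \<open>By \<open>d \<le> k / 5\<close> and \<open>\<eta> \<le> s / 2\<close>, the
        two bounds on \<open>E\<close> become a quadratic inequality in \<open>a\<close> that fails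
        between \<open>k / 8\<close> and \<open>7 * k / 10\<close>. The product of
        \<open>8 * a - k\<close> and \<open>7 * k - 10 * a\<close> certifies this.\<close>
      have "2 * a * ((k - a) * s) \<le> d * (k * s + a * \<eta>)"
        using lower sparse by (simp add: ts algebra_simps)
      also have "\<dots> \<le> (k / 5) * (k * s + a * (s / 2))"
        using kd s pos k by (intro mult_mono add_mono) auto
      finally have "s * (2 * a * (k - a)) \<le> s * ((k / 5) * (k + a / 2))"
        by (simp add: algebra_simps)
      then have "2 * a * (k - a) \<le> (k / 5) * (k + a / 2)"
        using s by simp
      then have 1: "20 * a * (k - a) \<le> 2 * k * k + k * a"
        by (simp add: algebra_simps)
      have "0 \<le> (8 * a - k) * (7 * k - 10 * a)" using ge a7 by simp
      then have 2: "80 * (a * a) \<le> 66 * (a * k) - 7 * (k * k)" by (simp add: algebra_simps)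
      have 3: "k * k \<le> 8 * (a * k)" using mult_right_mono[OF ge, of k] k by simp
      have "0 < k * k" using k by simp
      then show False using 1 2 3 by (simp add: algebra_simps)
    qed
    have ka: "0 < (k - a) * \<eta>" using a8 pos by simp
    have coeff: "0 \<le> k * \<eta> - a * t"
    proof -
      have "a * t \<le> a * (6 * \<eta>)" using t pos by simp
      also have "\<dots> \<le> k * \<eta>" using a8 pos mult_right_mono[of "6 * a" k \<eta>] by simp
      finally show ?thesis by simp
    qed
    \<comment> \<open>The factor \<open>(k - a) * \<eta>\<close> lets \<open>tradeoff\<close>
      eliminate \<open>h\<close>. What remains of \<open>S\<close> has the coefficient
      \<open>k * \<eta> - a * t\<close>, which is nonnegative, so the upper bound on
      \<open>S\<close> may be inserted.\<close>
    have "2 * a * ((k - a) * s) * ((k - a) * \<eta>) \<le> (S + a * s * h) * ((k - a) * \<eta>)"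
      using lower upper ka by (intro mult_right_mono) (auto simp: s_def)
    also have "\<dots> = S * ((k - a) * \<eta>) + a * s * ((k - a) * \<eta> * h)" by (simp add: algebra_simps)
    also have "\<dots> \<le> S * ((k - a) * \<eta>) + a * s * (d * k * (t + \<eta>) - S)"
      using tr pos s by (intro add_left_mono mult_left_mono) auto
    also have "\<dots> = S * (k * \<eta> - a * t) + a * s * (d * k * (t + \<eta>))"
      by (simp add: ts algebra_simps)
    also have "\<dots> \<le> 2 * k * (a * \<eta>) * (k * \<eta> - a * t) + a * s * (k / 5 * k * (t + \<eta>))"
      using S coeff pos s k kd ts by (intro add_mono mult_right_mono mult_left_mono) auto
    finally have "a * (2 * ((k - a) * s) * ((k - a) * \<eta>))
        \<le> a * (2 * k * \<eta> * (k * \<eta> - a * t) + s * (k / 5 * k * (t + \<eta>)))"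
      by (simp add: algebra_simps)
    then have main: "2 * ((k - a) * s) * ((k - a) * \<eta>)
        \<le> 2 * k * \<eta> * (k * \<eta> - a * t) + s * (k / 5 * k * (t + \<eta>))"
      using pos by simp
    \<comment> \<open>The bound is convex in \<open>s\<close>, so it suffices to refute it at \<open>s = 2\<eta>\<close> and \<open>s = 5\<eta>\<close>.\<close>
    have "0 \<le> (s - 2 * \<eta>) * (5 * \<eta> - s)" using s by simp
    then have "s * (s + 2 * \<eta>) \<le> \<eta> * (9 * s - 10 * \<eta>)" by (simp add: algebra_simps)
    then have "k / 5 * k * (s * (s + 2 * \<eta>)) \<le> k / 5 * k * (\<eta> * (9 * s - 10 * \<eta>))"
      using k by (intro mult_left_mono) auto
    then have "\<eta> * (2 * (k - a) * (k - a) * s)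
        \<le> \<eta> * (2 * k * (k * \<eta> - a * t) + k / 5 * k * (9 * s - 10 * \<eta>))"
      using main unfolding ts by (simp only: ring_distribs) (simp add: algebra_simps add_divide_distrib)
    then have lin: "2 * (k - a) * (k - a) * s
        \<le> 2 * k * (k * \<eta> - a * t) + k / 5 * k * (9 * s - 10 * \<eta>)"
      using pos by simp
    have lin': "s * (k * k / 5 - 2 * (k * a) + 2 * (a * a)) \<le> - 2 * (k * a) * \<eta>"
      using lin by (simp add: ts algebra_simps)
    have ak: "8 * (k * a) < k * k" "0 < k * a" "0 < a * a" "0 < k * k"
      using mult_strict_right_mono[OF a8 k] pos k by (simp_all add: mult.commute)
    \<comment> \<open>Interpolation between the endpoints: the sum is three times the affine
      function of \<open>s\<close> that \<open>lin'\<close> bounds by 0, and its endpoint values are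
      positive because \<open>8 * a < k\<close>.\<close>
    have neg: "0 < (5 * \<eta> - s) * (2 * (k*k/5 - 2 * (k * a) + 2 * (a * a)) + 2 * (k * a))
        + (s - 2 * \<eta>) * (5 * (k*k/5 - 2 * (k * a) + 2 * (a * a)) + 2 * (k * a))"
    proof -
      have p: "0 < 2 * (k*k/5 - 2 * (k * a) + 2 * (a * a)) + 2 * (k * a)"
           "0 < 5 * (k*k/5 - 2 * (k * a) + 2 * (a * a)) + 2 * (k * a)"
        using ak by argo+
      show ?thesis
      proof (cases "s = 5 * \<eta>")
        case True then show ?thesis using p pos by simp
      next
        case False then show ?thesis using p s by (intro add_pos_nonneg) auto
      qed
    qed
    also have "\<dots> = 3 * (s * (k * k / 5 - 2 * (k * a) + 2 * (a * a)) + 2 * (k * a) * \<eta>)"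
      by (simp add: field_simps)
    also have "\<dots> \<le> 0" using lin' pos by simp
    finally show False by simp
  qed
qed

section \<open>Colourings of sparse graphs by forests\<close>

lemma obtain_largest:
  fixes f :: "'a \<Rightarrow> 'b::linorder"
  assumes "finite W" "m \<le> card W"
  obtains X where "X \<subseteq> W" "card X = m" "\<And>x y. x \<in> X \<Longrightarrow> y \<in> W - X \<Longrightarrow> f y \<le> f x"
proof -
  have "\<exists>X\<subseteq>W. card X = m \<and> (\<forall>x\<in>X. \<forall>y\<in>W - X. f y \<le> f x)"
    using assms(2)
  proof (induction m)
    case 0
    then show ?case by (intro exI[of _ "{}"]) auto
  next
    case (Suc m)
    then obtain X where X: "X \<subseteq> W" "card X = m" "\<forall>x\<in>X. \<forall>y\<in>W - X. f y \<le> f x" by auto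
    have fin: "finite X" using X assms(1) finite_subset by blast
    have ne: "W - X \<noteq> {}"
    proof
      assume "W - X = {}"
      then have "W = X" using X by auto
      then show False using X Suc.prems by simp
    qed
    have "Max (f ` (W - X)) \<in> f ` (W - X)" using ne assms(1) by (intro Max_in) auto
    then obtain z where z: "z \<in> W - X" "f z = Max (f ` (W - X))" by auto
    have "\<forall>y\<in>W - X. f y \<le> f z" using z assms(1) by auto
    then show ?case
      using X z fin by (intro exI[of _ "insert z X"]) auto
  qed
  then show thesis using that by blast
qed

definition colour_set :: "'a set \<Rightarrow> ('a \<Rightarrow> nat) \<Rightarrow> nat \<Rightarrow> 'a set" where
  "colour_set U c i = {u \<in> U. c u = i}"

lemma card_Int_colours:
  assumes "finite U" "finite I"
  shows "card (Y \<inter> {u \<in> U. c u \<in> I}) = (\<Sum>i\<in>I. card (Y \<inter> colour_set U c i))"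
proof -
  have "Y \<inter> {u \<in> U. c u \<in> I} = (\<Union>i\<in>I. Y \<inter> colour_set U c i)"
    by (auto simp: colour_set_def)
  moreover have "card (\<Union>i\<in>I. Y \<inter> colour_set U c i) = (\<Sum>i\<in>I. card (Y \<inter> colour_set U c i))"
    using assms by (intro card_UN_disjoint) (auto simp: colour_set_def)
  ultimately show ?thesis by (simp only:)
qed

lemmas card_colours = card_Int_colours[of _ _ UNIV, simplified]

text \<open>Graphs as symmetric neighbourhood functions, so that degrees into a set are
  cardinalities of intersections. Degeneracy is stated for induced subgraphs only.\<close>

locale sparse_graph =
  fixes V :: "'a set" and N :: "'a \<Rightarrow> 'a set" and d :: nat
  assumes finite_V: "finite V"
    and N_subset: "N v \<subseteq> V"
    and irrefl_N: "v \<notin> N v"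
    and sym_N: "u \<in> N v \<Longrightarrow> v \<in> N u"
    and low_degree_vertex: "S \<subseteq> V \<Longrightarrow> S \<noteq> {} \<Longrightarrow> \<exists>v\<in>S. card (N v \<inter> S) \<le> d"
begin

section \<open>Degree sums in degenerate graphs\<close>

lemma finite_subset_V: "S \<subseteq> V \<Longrightarrow> finite S"
  using finite_V finite_subset by blast

lemma finite_N [simp]: "finite (N v)"
  using N_subset finite_subset_V by blast

text \<open>Double counting of the adjacent pairs in \<open>A \<times> B\<close>.\<close>

lemma sum_card_swap:
  assumes "finite A" "finite B"
  shows "(\<Sum>u\<in>A. card (N u \<inter> B)) = (\<Sum>u\<in>B. card (N u \<inter> A))"
proof -
  have eq: "card (N u \<inter> C) = (\<Sum>w\<in>C. if w \<in> N u then 1 else 0)" if "finite C" for u C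
  proof -
    have "N u \<inter> C = {w \<in> C. w \<in> N u}" by auto
    then show ?thesis using that by (simp add: sum.If_cases Int_def)
  qed
  have "(\<Sum>u\<in>A. card (N u \<inter> B)) = (\<Sum>u\<in>A. \<Sum>w\<in>B. if w \<in> N u then 1 else 0)"
    using eq assms by simp
  also have "\<dots> = (\<Sum>w\<in>B. \<Sum>u\<in>A. if w \<in> N u then 1 else 0)"
    by (rule sum.swap)
  also have "\<dots> = (\<Sum>w\<in>B. \<Sum>u\<in>A. if u \<in> N w then 1 else 0)"
    using sym_N by (intro sum.cong refl) metis
  finally show ?thesis using eq assms by simp
qed

lemma card_Int_Un:
  assumes "finite B" "finite C" "B \<inter> C = {}"
  shows "card (A \<inter> (B \<union> C)) = card (A \<inter> B) + card (A \<inter> C)"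
  using assms by (subst Int_Un_distrib, subst card_Un_disjoint) auto

text \<open>Deleting a vertex of degree at most \<open>d\<close> in \<open>S\<close> removes at most
  \<open>d\<close> edges, each counted twice.\<close>

lemma sum_degrees_le:
  assumes "S \<subseteq> V"
  shows "(\<Sum>u\<in>S. card (N u \<inter> S)) \<le> 2 * d * card S"
  using assms
proof (induction "card S" arbitrary: S)
  case 0
  then show ?case using finite_subset_V[of S] by simp
next
  case (Suc n)
  then have "finite S" "S \<noteq> {}" using finite_subset_V[of S] by auto
  then obtain v where v: "v \<in> S" "card (N v \<inter> S) \<le> d" using low_degree_vertex Suc by blast
  define T where "T = S - {v}"
  have S: "S = insert v T" "v \<notin> T" "finite T" using v \<open>finite S\<close> by (auto simp: T_def)
  have T: "(\<Sum>u\<in>T. card (N u \<inter> T)) \<le> 2 * d * card T"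
    using Suc S by (intro Suc) auto
  have degree_split: "card (N u \<inter> S) = card (N u \<inter> {v}) + card (N u \<inter> T)" for u
    using card_Int_Un[of "{v}" T] S by simp
  have "(\<Sum>u\<in>S. card (N u \<inter> S)) = card (N v \<inter> S) + (\<Sum>u\<in>T. card (N u \<inter> S))"
    using sum.remove[OF \<open>finite S\<close> v(1)] by (simp add: T_def)
  also have "(\<Sum>u\<in>T. card (N u \<inter> S)) = (\<Sum>u\<in>T. card (N u \<inter> {v})) + (\<Sum>u\<in>T. card (N u \<inter> T))"
    by (simp only: degree_split sum.distrib)
  also have "(\<Sum>u\<in>T. card (N u \<inter> {v})) = card (N v \<inter> T)"
    using sum_card_swap[of T "{v}"] S by simp
  also have "card (N v \<inter> T) \<le> card (N v \<inter> S)" using degree_split[of v] by simp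
  finally show ?case using T v S by simp
qed

text \<open>The degree sum of \<open>A \<union> B\<close> counts each edge between the two sets
  twice, which saves the factor 2.\<close>

lemma edges_between_le:
  assumes "A \<subseteq> V" "B \<subseteq> V" "A \<inter> B = {}"
  shows "(\<Sum>u\<in>A. card (N u \<inter> B)) \<le> d * (card A + card B)"
proof -
  have fin: "finite A" "finite B" using assms finite_subset_V by auto
  have "(\<Sum>u\<in>A. card (N u \<inter> B)) + (\<Sum>u\<in>B. card (N u \<inter> A)) \<le> (\<Sum>u\<in>A \<union> B. card (N u \<inter> (A \<union> B)))"
    using fin assms by (simp add: sum.union_disjoint card_Int_Un sum.distrib)
  also have "\<dots> \<le> 2 * d * (card A + card B)"
    using sum_degrees_le[of "A \<union> B"] assms fin by (simp add: card_Un_disjoint)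
  finally show ?thesis using sum_card_swap[OF fin] by simp
qed

text \<open>The sum counts edges inside \<open>X\<close> twice and edges leaving \<open>X\<close>
  once. It is thus at most the number of edges in \<open>W\<close> plus the number of edges in
  \<open>X\<close>.\<close>

lemma sum_degrees_subset_le:
  assumes "W \<subseteq> V" "X \<subseteq> W"
  shows "(\<Sum>u\<in>X. card (N u \<inter> W)) \<le> d * (card W + card X)"
proof -
  define Y where "Y = W - X"
  have fin: "finite X" "finite Y" using assms finite_subset_V[of W] finite_subset by (auto simp: Y_def)
  have W: "W = X \<union> Y" "X \<inter> Y = {}" using assms by (auto simp: Y_def)
  have "(\<Sum>u\<in>W. card (N u \<inter> W)) = (\<Sum>u\<in>X. card (N u \<inter> X)) + (\<Sum>u\<in>X. card (N u \<inter> Y))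
      + ((\<Sum>u\<in>Y. card (N u \<inter> X)) + (\<Sum>u\<in>Y. card (N u \<inter> Y)))"
    unfolding W(1) using fin W(2) by (simp add: sum.union_disjoint card_Int_Un sum.distrib)
  moreover have "(\<Sum>u\<in>Y. card (N u \<inter> X)) = (\<Sum>u\<in>X. card (N u \<inter> Y))"
    using fin by (rule sum_card_swap[symmetric])
  moreover have "(\<Sum>u\<in>X. card (N u \<inter> W)) = (\<Sum>u\<in>X. card (N u \<inter> X)) + (\<Sum>u\<in>X. card (N u \<inter> Y))"
    unfolding W(1) using fin W(2) by (simp add: card_Int_Un sum.distrib)
  moreover have "(\<Sum>u\<in>X. card (N u \<inter> X)) \<le> 2 * d * card X" "(\<Sum>u\<in>W. card (N u \<inter> W)) \<le> 2 * d * card W"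
    using assms by (auto intro!: sum_degrees_le)
  ultimately show ?thesis by (simp add: algebra_simps)
qed

section \<open>Forests and partial tree colourings\<close>

text \<open>A finite graph is a forest iff it is 1-degenerate.\<close>

definition induces_forest :: "'a set \<Rightarrow> bool" where
  "induces_forest S \<longleftrightarrow> (\<forall>T\<subseteq>S. T \<noteq> {} \<longrightarrow> (\<exists>v\<in>T. card (N v \<inter> T) \<le> 1))"

lemma induces_forest_subset: "induces_forest S \<Longrightarrow> T \<subseteq> S \<Longrightarrow> induces_forest T"
  unfolding induces_forest_def by blast

lemma induces_forest_insert:
  assumes "induces_forest S" "card (N v \<inter> S) \<le> 1"
  shows "induces_forest (insert v S)"
  unfolding induces_forest_def
proof (intro allI impI)
  fix T assume T: "T \<subseteq> insert v S" "T \<noteq> {}"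
  show "\<exists>v\<in>T. card (N v \<inter> T) \<le> 1"
  proof (cases "v \<in> T")
    case True
    have "card (N v \<inter> T) \<le> card (N v \<inter> S)"
      using T irrefl_N[of v] by (intro card_mono) auto
    then show ?thesis using assms True by (intro bexI[of _ v]) auto
  next
    case False
    then have "T \<subseteq> S" using T by auto
    then show ?thesis using assms T unfolding induces_forest_def by blast
  qed
qed

lemma induces_forest_card_le_2:
  assumes "finite S" "card S \<le> 2"
  shows "induces_forest S"
  unfolding induces_forest_def
proof (intro allI impI)
  fix T assume T: "T \<subseteq> S" "T \<noteq> {}"
  then obtain v where v: "v \<in> T" by auto
  have fin: "finite T" using T assms finite_subset by blast
  have "card (N v \<inter> T) \<le> card (T - {v})"
    using irrefl_N fin by (intro card_mono) auto
  also have "\<dots> \<le> 1" using v fin card_mono[OF assms(1) T(1)] assms by simp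
  finally show "\<exists>v\<in>T. card (N v \<inter> T) \<le> 1" using v by blast
qed

definition tree_colouring :: "nat \<Rightarrow> 'a set \<Rightarrow> ('a \<Rightarrow> nat) \<Rightarrow> bool" where
  "tree_colouring k U c \<longleftrightarrow>
     (\<forall>u\<in>U. c u \<in> {1..k}) \<and> (\<forall>i. induces_forest (colour_set U c i))"

lemma tree_colouring_insert:
  assumes "tree_colouring k U c" "v \<notin> U" "i \<in> {1..k}" "card (N v \<inter> colour_set U c i) \<le> 1"
  shows "tree_colouring k (insert v U) (c(v := i))"
    and "colour_set (insert v U) (c(v := i)) j =
      (if j = i then insert v (colour_set U c i) else colour_set U c j)"
proof -
  show eq: "colour_set (insert v U) (c(v := i)) j =
      (if j = i then insert v (colour_set U c i) else colour_set U c j)" for j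
    using assms(2) by (auto simp: colour_set_def)
  show "tree_colouring k (insert v U) (c(v := i))"
    unfolding tree_colouring_def eq
    using assms by (auto simp: tree_colouring_def intro: induces_forest_insert)
qed

lemma tree_colouring_remove:
  "tree_colouring k U c \<Longrightarrow> tree_colouring k (U - {w}) c"
  unfolding tree_colouring_def
  by (auto intro: induces_forest_subset simp: colour_set_def)

section \<open>Shifting vertices along a path of classes\<close>

text \<open>
  Moves the vertices along a path of colours, where every colour passes one vertex on to the next.
  The path has no repeated colour, so that a move does not invalidate the later ones.
\<close>

lemma shift_along_path:
  assumes "rtrancl_path r x xs y" "distinct (x # xs)"
    and r: "\<And>i j. r i j \<Longrightarrow> j \<in> {1..k} \<and> (\<exists>w\<in>colour_set U c i - H. card (N w \<inter> colour_set U c j) \<le> 1)"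
    and "finite U'" "tree_colouring k U' c'"
    and "\<And>j. j \<in> set (x # xs) \<Longrightarrow> colour_set U' c' j = colour_set U c j"
    and "v \<notin> U'" "v \<notin> H" "x \<in> {1..k}" "card (N v \<inter> colour_set U' c' x) \<le> 1"
  shows "\<exists>c''. tree_colouring k (insert v U') c'' \<and> (\<forall>u\<in>H. c'' u = c' u) \<and>
    (\<forall>j. card (colour_set (insert v U') c'' j) = card (colour_set U' c' j) + (if j = y then 1 else 0))"
  using assms(1,2,4-)
proof (induction arbitrary: U' c' v)
  case (base x)
  have fin: "finite (colour_set U' c' x)" and v: "v \<notin> colour_set U' c' x"
    using base.prems(2,5) by (auto simp: colour_set_def)
  note ins = tree_colouring_insert[OF base.prems(3,5,7,8)]
  have "card (colour_set (insert v U') (c'(v := x)) j) = card (colour_set U' c' j) + (if j = x then 1 else 0)" for j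
    unfolding ins(2) using fin v by simp
  moreover have "\<forall>u\<in>H. (c'(v := x)) u = c' u"
    using base.prems(6) by auto
  ultimately show ?case
    using ins(1) by blast
next
  case (step x z ys y)
  obtain w where w: "w \<in> colour_set U c x" "w \<notin> H" "card (N w \<inter> colour_set U c z) \<le> 1" and z: "z \<in> {1..k}"
    using r[OF step.hyps(1)] by blast
  have wU': "w \<in> colour_set U' c' x" using step.prems(4)[of x] w(1) by simp
  then have "w \<noteq> v" "w \<in> U'" "c' w = x" using step.prems(5) by (auto simp: colour_set_def)
  \<comment> \<open>\<open>v\<close> takes the place of \<open>w\<close> in class \<open>x\<close>,
    so no other class changes and all sizes stay the same. Then \<open>w\<close> is the vertex to be
    inserted along the rest of the path.\<close>
  define U1 where "U1 = insert v (U' - {w})"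
  define c1 where "c1 = c'(v := x)"
  have rem: "colour_set (U' - {w}) c' j = colour_set U' c' j - {w}" for j
    by (auto simp: colour_set_def)
  have "card (N v \<inter> colour_set (U' - {w}) c' x) \<le> card (N v \<inter> colour_set U' c' x)"
    by (intro card_mono) (auto simp: rem)
  then have "card (N v \<inter> colour_set (U' - {w}) c' x) \<le> 1" using step.prems(8) by linarith
  note ins = tree_colouring_insert[OF tree_colouring_remove[OF step.prems(3)] _ step.prems(7) this]
  have v': "v \<notin> U' - {w}" using step.prems(5) by simp
  have col1: "tree_colouring k U1 c1"
    unfolding U1_def c1_def by (rule ins(1)[OF v'])
  have cls1: "colour_set U1 c1 j = (if j = x then insert v (colour_set U' c' x - {w}) else colour_set U' c' j)" for j
    unfolding U1_def c1_def ins(2)[OF v'] rem using \<open>c' w = x\<close> by (auto simp: colour_set_def)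
  have "\<exists>c''. tree_colouring k (insert w U1) c'' \<and> (\<forall>u\<in>H. c'' u = c1 u) \<and>
    (\<forall>j. card (colour_set (insert w U1) c'' j) = card (colour_set U1 c1 j) + (if j = y then 1 else 0))"
  proof (rule step.IH)
    show cls: "colour_set U1 c1 j = colour_set U c j" if "j \<in> set (z # ys)" for j
    proof -
      have "j \<noteq> x" using that step.prems(1) by auto
      then show ?thesis using that step.prems(4)[of j] by (simp add: cls1)
    qed
    show "card (N w \<inter> colour_set U1 c1 z) \<le> 1" using w(3) cls[of z] by simp
    show "distinct (z # ys)" using step.prems(1) by simp
    show "finite U1" using step.prems(2) by (simp add: U1_def)
    show "w \<notin> U1" using \<open>w \<noteq> v\<close> by (simp add: U1_def)
  qed (fact col1 w(2) z)+
  moreover have "insert w U1 = insert v U'" using \<open>w \<in> U'\<close> by (auto simp: U1_def)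
  moreover have "card (colour_set U1 c1 j) = card (colour_set U' c' j)" for j
  proof (cases "j = x")
    case True
    have "finite (colour_set U' c' x)" "v \<notin> colour_set U' c' x"
      using step.prems(2,5) by (auto simp: colour_set_def)
    then show ?thesis using wU' True by (simp add: cls1 card_Suc_Diff1 del: card_Diff_singleton card_Diff_insert)
  qed (simp add: cls1)
  moreover have "c1 u = c' u" if "u \<in> H" for u
    using that step.prems(6) by (auto simp: c1_def)
  ultimately show ?case by auto
qed

section \<open>The stuck configuration\<close>

text \<open>
  \<open>Acc\<close> is the set of colours from which a class of size less than \<open>t\<close> can be reached by moving
  vertices outside \<open>H\<close>. All edges between its classes and the remaining vertices outside \<open>H\<close> are
  counted.
\<close>

lemma stuck_contradiction:
  fixes c :: "'a \<Rightarrow> nat" and k t \<eta> h :: nat and Acc :: "nat set"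
  defines "B \<equiv> {1..k} - Acc"
  assumes d: "0 < d" "5 * d \<le> k" and degree: "\<And>u. card (N u) \<le> 2 * k"
    and sets: "W \<subseteq> V" "U \<subseteq> W" "H \<subseteq> U" "H \<subseteq> X" "X \<subseteq> W"
    and low: "\<And>u. u \<in> U - H \<Longrightarrow> card (N u \<inter> W) \<le> h"
    and high: "\<And>u. u \<in> X \<Longrightarrow> h \<le> card (N u \<inter> W)"
    and colours: "\<And>u. u \<in> U \<Longrightarrow> c u \<in> {1..k}"
    and size: "\<And>i. i \<in> {1..k} \<Longrightarrow> card (colour_set U c i) \<le> t"
    and H: "\<And>i. i \<in> {1..k} \<Longrightarrow> card (colour_set H c i) = \<eta>"
    and card_W: "card W + k * \<eta> \<le> k * t + card X"
    and t: "1 \<le> \<eta>" "3 * \<eta> \<le> t" "t \<le> 6 * \<eta>"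
    and Acc: "Acc \<subseteq> {1..k}" "Acc \<noteq> {}" "2 * card Acc \<le> h"
    and full: "\<And>i. i \<in> B \<Longrightarrow> card (colour_set U c i) = t"
    and stuck: "\<And>u i. u \<in> U - H \<Longrightarrow> c u \<in> B \<Longrightarrow> i \<in> Acc \<Longrightarrow> 2 \<le> card (N u \<inter> colour_set U c i)"
  shows False
proof -
  have fin: "finite W" "finite X" "finite U" "finite H" "finite Acc" "finite B"
  proof -
    show "finite W" using sets(1) by (rule finite_subset_V)
    then show "finite X" "finite U" using sets(2,5) finite_subset by blast+
    then show "finite H" using sets(3) finite_subset by blast
    show "finite Acc" using Acc(1) finite_subset by blast
    show "finite B" by (simp add: B_def)
  qed
  have Acc_k: "i \<in> {1..k}" if "i \<in> Acc" for i using that Acc(1) by blast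
  have B_k: "i \<in> {1..k}" if "i \<in> B" for i using that by (simp add: B_def)
  define a where "a = card Acc"
  have a: "0 < a" "a \<le> k"
    using Acc fin card_mono[of "{1..k}" Acc] by (auto simp: a_def card_gt_0_iff)
  have card_B: "card B = k - a"
    using Acc fin by (simp add: B_def a_def card_Diff_subset)
  \<comment> \<open>First letters \<open>A\<close> and \<open>B\<close> refer to accessible and
    inaccessible classes; a second letter \<open>H\<close> marks kept vertices and \<open>L\<close>
    the movable ones, of low degree.\<close>
  define A where "A = {u \<in> U. c u \<in> Acc}"
  define AH where "AH = {u \<in> H. c u \<in> Acc}"
  define AL where "AL = {u \<in> U - H. c u \<in> Acc}"
  define BL where "BL = {u \<in> U - H. c u \<in> B}"
  have A: "A = AH \<union> AL" "AH \<inter> AL = {}" using sets by (auto simp: A_def AH_def AL_def)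
  have fins: "finite A" "finite AH" "finite AL" "finite BL"
    using fin by (auto simp: A_def AH_def AL_def BL_def)
  have diff: "card (colour_set (U - H) c i) = card (colour_set U c i) - \<eta>" if "i \<in> {1..k}" for i
  proof -
    have "colour_set (U - H) c i = colour_set U c i - colour_set H c i"
      by (auto simp: colour_set_def)
    then show ?thesis
      using H[OF that] fin sets card_Diff_subset[of "colour_set H c i" "colour_set U c i"]
      by (auto simp: colour_set_def)
  qed
  have card_A: "card A \<le> a * t"
  proof -
    have "(\<Sum>i\<in>Acc. card (colour_set U c i)) \<le> (\<Sum>i\<in>Acc. t)"
      by (intro sum_mono size Acc_k)
    then show ?thesis using card_colours[of U Acc c] fin by (simp add: A_def a_def)
  qed
  have card_AH: "card AH = a * \<eta>"
  proof -
    have "(\<Sum>i\<in>Acc. card (colour_set H c i)) = (\<Sum>i\<in>Acc. \<eta>)"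
      by (intro sum.cong refl H Acc_k)
    then show ?thesis using card_colours[of H Acc c] fin by (simp add: AH_def a_def)
  qed
  have card_AL: "card AL \<le> a * (t - \<eta>)"
  proof -
    have "(\<Sum>i\<in>Acc. card (colour_set (U - H) c i)) \<le> (\<Sum>i\<in>Acc. t - \<eta>)"
    proof (rule sum_mono)
      fix i assume "i \<in> Acc"
      then show "card (colour_set (U - H) c i) \<le> t - \<eta>"
        using diff[OF Acc_k] size[OF Acc_k] by (simp add: diff_le_mono)
    qed
    then show ?thesis using card_colours[of "U - H" Acc c] fin by (simp add: AL_def a_def)
  qed
  have card_BL: "card BL = (k - a) * (t - \<eta>)"
  proof -
    have "(\<Sum>i\<in>B. card (colour_set (U - H) c i)) = (\<Sum>i\<in>B. t - \<eta>)"
      by (intro sum.cong refl) (simp add: diff[OF B_k] full)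
    then show ?thesis using card_colours[of "U - H" B c] fin card_B by (simp add: BL_def)
  qed
  have card_H: "card H = k * \<eta>"
  proof -
    have "H = {u \<in> H. c u \<in> {1..k}}" using colours sets by auto
    then have "card H = (\<Sum>i\<in>{1..k}. card (colour_set H c i))"
      using card_colours[OF fin(4), of "{1..k}" c] by simp
    also have "\<dots> = (\<Sum>i\<in>{1..k}. \<eta>)" by (intro sum.cong refl H)
    finally show ?thesis by simp
  qed
  have card_X: "k * \<eta> \<le> card X" using card_mono[OF fin(2) sets(4)] card_H by simp

  define E where "E = (\<Sum>u\<in>BL. card (N u \<inter> A))"
  define S where "S = (\<Sum>u\<in>AH. card (N u \<inter> W))"
  have E_swap: "E = (\<Sum>u\<in>A. card (N u \<inter> BL))"
    unfolding E_def using fins by (intro sum_card_swap)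
  have lower: "2 * a * ((k - a) * (t - \<eta>)) \<le> E"
  proof -
    have "2 * a \<le> card (N u \<inter> A)" if "u \<in> BL" for u
    proof -
      have "(\<Sum>i\<in>Acc. 2) \<le> (\<Sum>i\<in>Acc. card (N u \<inter> colour_set U c i))"
        using that stuck by (intro sum_mono) (auto simp: BL_def)
      then show ?thesis using card_Int_colours[of U Acc "N u" c] fin by (simp add: A_def a_def)
    qed
    then have "(\<Sum>u\<in>BL. 2 * a) \<le> E" unfolding E_def by (intro sum_mono)
    then show ?thesis by (simp add: card_BL algebra_simps)
  qed
  have sparse_E: "E \<le> d * (a * t + (k - a) * (t - \<eta>))"
  proof -
    have "A \<subseteq> V" "BL \<subseteq> V" "A \<inter> BL = {}" using sets by (auto simp: A_def BL_def B_def)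
    then have "E \<le> d * (card A + card BL)" unfolding E_swap by (rule edges_between_le)
    also have "\<dots> \<le> d * (a * t + (k - a) * (t - \<eta>))" using card_A by (simp add: card_BL)
    finally show ?thesis .
  qed
  have upper: "E \<le> S + a * (t - \<eta>) * h"
  proof -
    have "E \<le> (\<Sum>u\<in>A. card (N u \<inter> W))"
      unfolding E_swap using sets by (intro sum_mono card_mono) (auto simp: BL_def)
    also have "\<dots> = S + (\<Sum>u\<in>AL. card (N u \<inter> W))"
      unfolding A(1) S_def using fins A(2) by (intro sum.union_disjoint)
    also have "(\<Sum>u\<in>AL. card (N u \<inter> W)) \<le> card AL * h"
      using sum_bounded_above[of AL "\<lambda>u. card (N u \<inter> W)" h] low by (auto simp: AL_def)
    also have "\<dots> \<le> a * (t - \<eta>) * h" using card_AL by simp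
    finally show ?thesis by simp
  qed
  have S_lower: "a * \<eta> * h \<le> S"
  proof -
    have "(\<Sum>u\<in>AH. h) \<le> S"
      unfolding S_def using sets(4) by (intro sum_mono high) (auto simp: AH_def)
    then show ?thesis by (simp add: card_AH)
  qed
  have S_upper: "S \<le> 2 * k * (a * \<eta>)"
  proof -
    have "card (N u \<inter> W) \<le> 2 * k" for u
      using card_mono[of "N u" "N u \<inter> W"] degree[of u] by simp
    then have "S \<le> card AH * (2 * k)" unfolding S_def using sum_bounded_above[of AH "\<lambda>u. card (N u \<inter> W)" "2 * k"] by auto
    then show ?thesis by (simp add: card_AH algebra_simps)
  qed
  \<comment> \<open>The degree sum over \<open>X\<close> within \<open>W\<close>: the vertices of
    \<open>AH\<close> contribute \<open>S\<close>, all others at least \<open>h\<close>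
    each.\<close>
  have total: "S + (card X - a * \<eta>) * h \<le> d * (card W + card X)"
  proof -
    have sub: "AH \<subseteq> X" using sets by (auto simp: AH_def)
    have "(card X - a * \<eta>) * h \<le> (\<Sum>u\<in>X - AH. card (N u \<inter> W))"
    proof -
      have "(\<Sum>u\<in>X - AH. h) \<le> (\<Sum>u\<in>X - AH. card (N u \<inter> W))"
        by (intro sum_mono high) auto
      then show ?thesis using fins sub by (simp add: card_Diff_subset card_AH)
    qed
    moreover have "(\<Sum>u\<in>X. card (N u \<inter> W)) = (\<Sum>u\<in>X - AH. card (N u \<inter> W)) + S"
      unfolding S_def using sum.subset_diff[OF sub fin(2)] .
    ultimately show ?thesis using sum_degrees_subset_le[OF sets(1,5)] by simp
  qed
  have aX: "a * \<eta> \<le> card X" using card_X mult_le_mono1[OF a(2), of \<eta>] by linarith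
  \<comment> \<open>Let \<open>x\<close> be the excess of \<open>card X\<close> over
    \<open>k * \<eta>\<close>. It adds \<open>x * h\<close> on the left and at most
    \<open>2 * d * x\<close> on the right, through \<open>card W\<close> and \<open>card X\<close>,
    so for \<open>2 * d < h\<close> it can be discarded.\<close>
  have tradeoff: "real S + (real k - real a) * real \<eta> * real h \<le> real d * real k * (real t + real \<eta>)"
    if "2 * real d < real h"
  proof -
    define x where "x = real (card X) - real k * real \<eta>"
    have x: "0 \<le> x" using card_X by (simp add: x_def flip: of_nat_mult)
    have W: "real (card W) \<le> real k * real t + x"
      using card_W by (simp add: x_def flip: of_nat_mult of_nat_add)
    have "real S + (real (card X) - real a * real \<eta>) * real h \<le> real d * (real (card W) + real (card X))"
      using total aX by (simp flip: of_nat_mult of_nat_add of_nat_diff)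
    also have "\<dots> \<le> real d * (real k * real t + 2 * x + real k * real \<eta>)"
    proof (rule mult_left_mono)
      show "real (card W) + real (card X) \<le> real k * real t + 2 * x + real k * real \<eta>"
        using W unfolding x_def by argo
    qed simp
    finally have "real S + (real k - real a) * real \<eta> * real h + x * real h
        \<le> real d * real k * (real t + real \<eta>) + x * (2 * real d)"
      by (simp add: x_def algebra_simps)
    moreover have "x * (2 * real d) \<le> x * real h" using that x by (intro mult_left_mono) auto
    ultimately show ?thesis by linarith
  qed
  have \<eta>t: "\<eta> \<le> t" using t by simp
  note reals = of_nat_diff[OF a(2), where ?'a = real] of_nat_diff[OF \<eta>t, where ?'a = real]
  show False
  proof (rule counting_contradiction[of "real d" "real a" "real \<eta>" "real k" "real t" "real E" "real S" "real h"])
    show "2 * real a * ((real k - real a) * (real t - real \<eta>)) \<le> real E"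
      unfolding reals[symmetric] using lower by (metis of_nat_le_iff of_nat_mult of_nat_numeral)
    show "real E \<le> real d * (real a * real t + (real k - real a) * (real t - real \<eta>))"
      unfolding reals[symmetric] using sparse_E by (metis of_nat_le_iff of_nat_mult of_nat_add)
    show "real E \<le> real S + real a * (real t - real \<eta>) * real h"
      unfolding reals[symmetric] using upper by (metis of_nat_le_iff of_nat_mult of_nat_add)
    show "real a * real \<eta> * real h \<le> real S"
      using S_lower by (metis of_nat_le_iff of_nat_mult)
    show "real S \<le> 2 * real k * (real a * real \<eta>)"
      using S_upper by (metis of_nat_le_iff of_nat_mult of_nat_numeral)
  qed (use d a t Acc tradeoff in \<open>auto simp: a_def\<close>)
qed

section \<open>Adding uncoloured vertices under a cap on the class sizes\<close>

text \<open>If an accessible class has at most one neighbour of \<open>v\<close>, a shift makes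
  room. Otherwise \<open>v\<close> has two neighbours in each accessible class, so
  \<open>2 * card Acc \<le> h\<close>, and for \<open>t > 2\<close> the stuck configuration is
  contradictory. The set \<open>X\<close> may contain uncoloured vertices of high degree besides
  \<open>H\<close>; they allow \<open>card W\<close> to exceed \<open>k * t\<close>.\<close>

lemma extend_colouring:
  fixes c :: "'a \<Rightarrow> nat" and k t \<eta> h :: nat
  assumes d: "0 < d" "5 * d \<le> k" and degree: "\<And>u. card (N u) \<le> 2 * k"
    and sets: "W \<subseteq> V" "U \<subseteq> W" "H \<subseteq> U" "H \<subseteq> X" "X \<subseteq> W" "v \<in> W - U"
    and low: "\<And>u. u \<in> insert v U - H \<Longrightarrow> card (N u \<inter> W) \<le> h"
    and high: "\<And>u. u \<in> X \<Longrightarrow> h \<le> card (N u \<inter> W)"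
    and col: "tree_colouring k U c"
    and size: "\<And>i. i \<in> {1..k} \<Longrightarrow> card (colour_set U c i) \<le> t"
    and H: "\<And>i. i \<in> {1..k} \<Longrightarrow> card (colour_set H c i) = \<eta>"
    and card_W: "card W + k * \<eta> \<le> k * t + card X"
    and card_U: "card U < k * t"
    and t: "t \<le> 2 \<or> 1 \<le> \<eta> \<and> 3 * \<eta> \<le> t \<and> t \<le> 6 * \<eta>"
  shows "\<exists>c'. tree_colouring k (insert v U) c' \<and> (\<forall>u\<in>H. c' u = c u) \<and>
    (\<forall>i\<in>{1..k}. card (colour_set U c i) \<le> card (colour_set (insert v U) c' i) \<and>
      card (colour_set (insert v U) c' i) \<le> t)"
proof -
  have fin: "finite U" using sets finite_subset_V[of W] finite_subset by blast
  have v: "v \<notin> U" "v \<notin> H" using sets by auto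
  define r where "r i j \<longleftrightarrow> i \<in> {1..k} \<and> j \<in> {1..k} \<and>
    (\<exists>w\<in>colour_set U c i - H. card (N w \<inter> colour_set U c j) \<le> 1)" for i j
  define Acc where "Acc = {i \<in> {1..k}. \<exists>j\<in>{1..k}. card (colour_set U c j) < t \<and> r\<^sup>*\<^sup>* i j}"
  have colours: "c u \<in> {1..k}" if "u \<in> U" for u
    using col that by (auto simp: tree_colouring_def)
  have "\<exists>s\<in>{1..k}. card (colour_set U c s) < t"
  proof (rule ccontr)
    assume "\<not> ?thesis"
    then have "(\<Sum>s\<in>{1..k}. t) \<le> (\<Sum>s\<in>{1..k}. card (colour_set U c s))"
      by (intro sum_mono) (auto simp: not_less)
    moreover have "U = {u \<in> U. c u \<in> {1..k}}" using colours by auto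
    ultimately show False using card_colours[OF fin, of "{1..k}" c] card_U by simp
  qed
  then obtain s where s: "s \<in> {1..k}" "card (colour_set U c s) < t" by blast
  show ?thesis
  proof (cases "\<exists>i\<in>Acc. card (N v \<inter> colour_set U c i) \<le> 1")
    case True
    have r: "j \<in> {1..k} \<and> (\<exists>w\<in>colour_set U c i - H. card (N w \<inter> colour_set U c j) \<le> 1)"
      if "r i j" for i j using that by (simp only: r_def)
    from True obtain i j where i: "i \<in> {1..k}" "card (N v \<inter> colour_set U c i) \<le> 1"
      and j: "j \<in> {1..k}" "card (colour_set U c j) < t" "r\<^sup>*\<^sup>* i j"
      by (auto simp: Acc_def)
    obtain xs where path: "rtrancl_path r i xs j" "distinct (i # xs)"
      using j(3) unfolding rtranclp_eq_rtrancl_path by (meson rtrancl_path_distinct)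
    obtain c'' where "tree_colouring k (insert v U) c''" "\<forall>u\<in>H. c'' u = c u" and
      c'': "\<And>j'. card (colour_set (insert v U) c'' j') = card (colour_set U c j') + (if j' = j then 1 else 0)"
      using shift_along_path[OF path r fin col _ v i] by blast
    moreover have "card (colour_set U c l) \<le> card (colour_set (insert v U) c'' l) \<and>
        card (colour_set (insert v U) c'' l) \<le> t" if "l \<in> {1..k}" for l
      using c''[of l] j(2) size[OF that] by (cases "l = j") auto
    ultimately show ?thesis by blast
  next
    case False
    show ?thesis
    proof (cases "t \<le> 2")
      case True
      have cset: "colour_set (insert v U) (c(v := s)) j = (if j = s then insert v (colour_set U c s) else colour_set U c j)" for j
        using v(1) by (auto simp: colour_set_def)
      have fin_s: "finite (colour_set U c s)" "v \<notin> colour_set U c s"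
        using fin v by (auto simp: colour_set_def)
      have "tree_colouring k (insert v U) (c(v := s))"
        unfolding tree_colouring_def cset
        using col s fin_s True by (auto simp: tree_colouring_def intro!: induces_forest_card_le_2)
      moreover have "\<forall>u\<in>H. (c(v := s)) u = c u" using v by auto
      moreover have "\<forall>i\<in>{1..k}. card (colour_set U c i) \<le> card (colour_set (insert v U) (c(v := s)) i) \<and>
        card (colour_set (insert v U) (c(v := s)) i) \<le> t"
        unfolding cset using fin_s s size by auto
      ultimately show ?thesis by blast
    next
      case t2: False
      have "2 * card Acc \<le> h"
      proof -
        have Acc_fin: "finite Acc" by (simp add: Acc_def)
        have "(\<Sum>i\<in>Acc. 2) \<le> (\<Sum>i\<in>Acc. card (N v \<inter> colour_set U c i))"
          using False by (intro sum_mono) auto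
        then have "2 * card Acc \<le> card (N v \<inter> {u \<in> U. c u \<in> Acc})"
          using card_Int_colours[OF fin Acc_fin, of "N v" c] by simp
        also have "\<dots> \<le> card (N v \<inter> W)" using sets by (intro card_mono) auto
        also have "\<dots> \<le> h" using low v by auto
        finally show ?thesis .
      qed
      have False
      proof (rule stuck_contradiction[OF d degree sets(1-5) _ high colours size H card_W])
        show "card (N u \<inter> W) \<le> h" if "u \<in> U - H" for u
          using that by (intro low) auto
        show "1 \<le> \<eta>" "3 * \<eta> \<le> t" "t \<le> 6 * \<eta>" using t t2 by auto
        show "Acc \<subseteq> {1..k}" by (auto simp: Acc_def)
        have "s \<in> Acc" using s by (auto simp: Acc_def)
        then show "Acc \<noteq> {}" by blast
        show "2 * card Acc \<le> h" by fact
        show "card (colour_set U c i) = t" if "i \<in> {1..k} - Acc" for i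
        proof -
          have "\<not> card (colour_set U c i) < t" using that by (auto simp: Acc_def)
          then show ?thesis using size[of i] that by simp
        qed
        show "2 \<le> card (N u \<inter> colour_set U c i)"
          if "u \<in> U - H" "c u \<in> {1..k} - Acc" "i \<in> Acc" for u i
        proof (rule ccontr)
          assume "\<not> ?thesis"
          then have "card (N u \<inter> colour_set U c i) \<le> 1" by simp
          moreover have "u \<in> colour_set U c (c u) - H" using that by (auto simp: colour_set_def)
          \<comment> \<open>A movable vertex with at most one neighbour in an accessible class would
            make its own class accessible.\<close>
          ultimately have "r (c u) i" using that unfolding r_def Acc_def by blast
          then have "c u \<in> Acc"
            using that by (auto simp: Acc_def intro: converse_rtranclp_into_rtranclp)
          then show False using that by auto
        qed
      qed
      then show ?thesis ..
    qed
  qed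
qed

text \<open>Iterates the one-vertex extension. The conclusion records that no class shrinks, which
  later supplies the lower bound on the class sizes.\<close>

lemma extend_colouring_set:
  fixes c :: "'a \<Rightarrow> nat" and k t \<eta> h :: nat
  assumes d: "0 < d" "5 * d \<le> k" and degree: "\<And>u. card (N u) \<le> 2 * k"
    and sets: "W \<subseteq> V" "H \<subseteq> U" "H \<subseteq> X" "X \<subseteq> W"
    and high: "\<And>u. u \<in> X \<Longrightarrow> h \<le> card (N u \<inter> W)"
    and H: "\<And>i. i \<in> {1..k} \<Longrightarrow> card (colour_set H c i) = \<eta>"
    and card_W: "card W + k * \<eta> \<le> k * t + card X"
    and t: "t \<le> 2 \<or> 1 \<le> \<eta> \<and> 3 * \<eta> \<le> t \<and> t \<le> 6 * \<eta>"
    and col: "tree_colouring k U c"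
    and size: "\<And>i. i \<in> {1..k} \<Longrightarrow> card (colour_set U c i) \<le> t"
    and Z: "finite Z" "U \<union> Z \<subseteq> W" "U \<inter> Z = {}" "card U + card Z \<le> k * t"
    and low: "\<And>u. u \<in> U \<union> Z - H \<Longrightarrow> card (N u \<inter> W) \<le> h"
  shows "\<exists>c'. tree_colouring k (U \<union> Z) c' \<and> (\<forall>u\<in>H. c' u = c u) \<and>
    (\<forall>i\<in>{1..k}. card (colour_set U c i) \<le> card (colour_set (U \<union> Z) c' i) \<and>
      card (colour_set (U \<union> Z) c' i) \<le> t)"
  using Z low
proof (induction Z rule: finite_induct)
  case empty
  show ?case using col size by auto
next
  case (insert v Z)
  have "\<exists>c'. tree_colouring k (U \<union> Z) c' \<and> (\<forall>u\<in>H. c' u = c u) \<and>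
    (\<forall>i\<in>{1..k}. card (colour_set U c i) \<le> card (colour_set (U \<union> Z) c' i) \<and>
      card (colour_set (U \<union> Z) c' i) \<le> t)"
  proof (rule insert.IH)
    show "U \<union> Z \<subseteq> W" "U \<inter> Z = {}" "card U + card Z \<le> k * t"
      using insert.prems insert.hyps by auto
    show "card (N u \<inter> W) \<le> h" if "u \<in> U \<union> Z - H" for u
      using that by (intro insert.prems(4)) auto
  qed
  then obtain c' where c': "tree_colouring k (U \<union> Z) c'" "\<And>u. u \<in> H \<Longrightarrow> c' u = c u"
    "\<And>i. i \<in> {1..k} \<Longrightarrow> card (colour_set U c i) \<le> card (colour_set (U \<union> Z) c' i)"
    "\<And>i. i \<in> {1..k} \<Longrightarrow> card (colour_set (U \<union> Z) c' i) \<le> t" by blast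
  have H': "card (colour_set H c' i) = \<eta>" if "i \<in> {1..k}" for i
  proof -
    have "colour_set H c' i = colour_set H c i" using c'(2) by (auto simp: colour_set_def)
    then show ?thesis using H[OF that] by simp
  qed
  have eq: "insert v (U \<union> Z) = U \<union> insert v Z" by blast
  have "\<exists>c''. tree_colouring k (insert v (U \<union> Z)) c'' \<and> (\<forall>u\<in>H. c'' u = c' u) \<and>
    (\<forall>i\<in>{1..k}. card (colour_set (U \<union> Z) c' i) \<le> card (colour_set (insert v (U \<union> Z)) c'' i) \<and>
      card (colour_set (insert v (U \<union> Z)) c'' i) \<le> t)"
  proof (rule extend_colouring[OF d degree sets(1) _ _ sets(3,4) _ _ high c'(1,4) H' card_W _ t])
    show "U \<union> Z \<subseteq> W" "v \<in> W - (U \<union> Z)" using insert.prems(1,2) insert.hyps(2) by auto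
    show "H \<subseteq> U \<union> Z" using sets(2) by blast
    show "card (N u \<inter> W) \<le> h" if "u \<in> insert v (U \<union> Z) - H" for u
      using that by (intro insert.prems(4)) auto
    show "card (U \<union> Z) < k * t"
      using card_Un_le[of U Z] insert.prems(3) insert.hyps by simp
  qed
  then obtain c'' where c'': "tree_colouring k (insert v (U \<union> Z)) c''" "\<And>u. u \<in> H \<Longrightarrow> c'' u = c' u"
    "\<And>i. i \<in> {1..k} \<Longrightarrow> card (colour_set (U \<union> Z) c' i) \<le> card (colour_set (insert v (U \<union> Z)) c'' i)"
    "\<And>i. i \<in> {1..k} \<Longrightarrow> card (colour_set (insert v (U \<union> Z)) c'' i) \<le> t" by blast
  have "card (colour_set U c i) \<le> card (colour_set (insert v (U \<union> Z)) c'' i)" if "i \<in> {1..k}" for i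
    using c'(3)[OF that] c''(3)[OF that] by linarith
  then show ?case
    using c'' c'(2) unfolding eq by (intro exI[of _ c'']) simp
qed

section \<open>The induction on the vertex set\<close>

lemma card_tree_colouring:
  assumes "tree_colouring k U c" "U \<subseteq> V"
  shows "card U = (\<Sum>i\<in>{1..k}. card (colour_set U c i))"
proof -
  have "U = {u \<in> U. c u \<in> {1..k}}" using assms(1) by (auto simp: tree_colouring_def)
  then show ?thesis
    using card_colours[OF finite_subset_V[OF assms(2)], of "{1..k}" c] by simp
qed

text \<open>The two bounds are \<open>card W / k\<close> rounded down and up. In the induction
  \<open>card H = k * \<eta>\<close> is a multiple of \<open>k\<close>, so both bounds equal
  \<open>\<eta>\<close> for \<open>H\<close>. The remaining vertices are added in two stages, with
  caps \<open>q\<close> and \<open>q + 1\<close>.\<close>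

lemma equitable_tree_colouring_exists:
  assumes d: "0 < d" "5 * d \<le> k" and degree: "\<And>u. card (N u) \<le> 2 * k"
    and "W \<subseteq> V"
  shows "\<exists>c. tree_colouring k W c \<and> (\<forall>i\<in>{1..k}. card W div k \<le> card (colour_set W c i) \<and>
    card (colour_set W c i) \<le> (card W + k - 1) div k)"
  using \<open>W \<subseteq> V\<close>
proof (induction "card W" arbitrary: W rule: less_induct)
  case less
  have k: "0 < k" using d by simp
  have finW: "finite W" using less.prems by (rule finite_subset_V)
  show ?case
  proof (cases "W = {}")
    case True
    then show ?thesis
      by (auto simp: tree_colouring_def colour_set_def induces_forest_def)
  next
    case False
    define q where "q = card W div k"
    define r where "r = card W mod k"
    \<comment> \<open>This choice gives \<open>3 * \<eta> \<le> t \<le> 6 * \<eta>\<close> for both caps \<open>t = q\<close> and \<open>t = q + 1\<close> that exceed 2.\<close>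
    define \<eta> where "\<eta> = (if q = 2 then 1 else q div 3)"
    define deg where "deg u = card (N u \<inter> W)" for u
    have W: "card W = k * q + r" "r < k" using k by (auto simp: q_def r_def)
    have \<eta>q: "\<eta> \<le> q" "\<eta> = 0 \<or> \<eta> < q" by (auto simp: \<eta>_def)
    have t1: "q \<le> 2 \<or> 1 \<le> \<eta> \<and> 3 * \<eta> \<le> q \<and> q \<le> 6 * \<eta>"
      and t2: "q + 1 \<le> 2 \<or> 1 \<le> \<eta> \<and> 3 * \<eta> \<le> q + 1 \<and> q + 1 \<le> 6 * \<eta>"
      unfolding \<eta>_def by (cases "q = 2"; simp; presburger)+
    have \<eta>W: "k * \<eta> \<le> k * q" using \<eta>q by simp
    then have \<eta>W': "k * \<eta> \<le> card W" using W(1) by linarith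
    have div_up: "(k * x + k - 1) div k = x" for x
      using k by (intro div_nat_eqI) auto
    obtain H where H: "H \<subseteq> W" "card H = k * \<eta>" "\<And>x y. x \<in> H \<Longrightarrow> y \<in> W - H \<Longrightarrow> deg y \<le> deg x"
      using obtain_largest[OF finW \<eta>W', of deg] by blast
    have finH: "finite H" using H finW finite_subset by blast
    have card_WH: "card (W - H) = card W - k * \<eta>"
      using card_Diff_subset[OF finH H(1)] H(2) by simp
    then have "r \<le> card (W - H)" using W(1) \<eta>W by linarith
    then obtain R where R: "R \<subseteq> W - H" "card R = r" "\<And>x y. x \<in> R \<Longrightarrow> y \<in> W - H - R \<Longrightarrow> deg y \<le> deg x"
      using obtain_largest[of "W - H" r deg] finW by blast
    have finR: "finite R" using R finW finite_subset by blast
    have "card H < card W"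
    proof (cases "\<eta> = 0")
      case True
      then show ?thesis using H False finW by (simp add: card_gt_0_iff)
    next
      case False
      then have "k * \<eta> < k * q" using \<eta>q k by simp
      then show ?thesis using H(2) W(1) by linarith
    qed
    moreover have "card H div k = \<eta>" "(card H + k - 1) div k = \<eta>"
      unfolding H(2) using k div_up by auto
    ultimately have "\<exists>c. tree_colouring k H c \<and> (\<forall>i\<in>{1..k}. \<eta> \<le> card (colour_set H c i) \<and>
        card (colour_set H c i) \<le> \<eta>)"
      using less.hyps[of H] H(1) less.prems by simp
    then obtain c0 where c0: "tree_colouring k H c0"
      and H_card: "\<And>i. i \<in> {1..k} \<Longrightarrow> card (colour_set H c0 i) = \<eta>"
      using order.antisym by blast

    \<comment> \<open>First all vertices outside \<open>R\<close> are coloured, with every class of size \<open>q\<close>. Leaving out \<open>R\<close>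
      lowers the degrees of the movable vertices enough for the cap \<open>q\<close>.\<close>
    define h1 where "h1 = Max (insert 0 (deg ` (W - H - R)))"
    define h2 where "h2 = Max (insert 0 (deg ` (W - H)))"
    define Z where "Z = W - H - R"
    define U where "U = H \<union> Z"
    have finZ: "finite Z" using finW by (simp add: Z_def)
    have cardZ: "card Z = k * q - k * \<eta>"
      using card_Diff_subset[OF finR R(1)] card_WH R(2) W(1) \<eta>W unfolding Z_def by linarith
    have "\<exists>c1. tree_colouring k (H \<union> Z) c1 \<and> (\<forall>u\<in>H. c1 u = c0 u) \<and>
      (\<forall>i\<in>{1..k}. card (colour_set H c0 i) \<le> card (colour_set (H \<union> Z) c1 i) \<and>
        card (colour_set (H \<union> Z) c1 i) \<le> q)"
    proof (rule extend_colouring_set[OF d degree less.prems order.refl _ _ _ H_card _ t1 c0 _ finZ])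
      show "H \<subseteq> H \<union> R" "H \<union> R \<subseteq> W" "H \<union> Z \<subseteq> W" "H \<inter> Z = {}" using H R by (auto simp: Z_def)
      show "h1 \<le> card (N u \<inter> W)" if "u \<in> H \<union> R" for u
        using that H(3)[of u] R(3)[of u] finW unfolding h1_def deg_def
        by (subst Max_le_iff) auto
      show "card (N u \<inter> W) \<le> h1" if "u \<in> H \<union> Z - H" for u
        using that finW unfolding h1_def deg_def Z_def by (intro Max_ge) auto
      have "card (H \<union> R) = card H + card R"
        using R finH finR by (intro card_Un_disjoint) auto
      then show "card W + k * \<eta> \<le> k * q + card (H \<union> R)" using H R W by simp
      show "card (colour_set H c0 i) \<le> q" if "i \<in> {1..k}" for i
        using H_card[OF that] \<eta>q by simp
      show "card H + card Z \<le> k * q" using H(2) cardZ \<eta>W by linarith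
    qed
    then obtain c1 where c1: "tree_colouring k U c1" "\<And>u. u \<in> H \<Longrightarrow> c1 u = c0 u"
      "\<And>i. i \<in> {1..k} \<Longrightarrow> card (colour_set U c1 i) \<le> q"
      unfolding U_def by blast
    have U: "U \<subseteq> W" "H \<subseteq> U" "U \<inter> R = {}" "U \<union> R = W" using H R by (auto simp: U_def Z_def)
    have "card U = card H + card Z"
      unfolding U_def using finH finZ by (intro card_Un_disjoint) (auto simp: Z_def)
    then have cardU: "card U = k * q" using H(2) cardZ \<eta>W by linarith
    \<comment> \<open>The \<open>k\<close> classes have size at most \<open>q\<close> and total size
      \<open>k * q\<close>.\<close>
    have U_card: "card (colour_set U c1 i) = q" if "i \<in> {1..k}" for i
    proof (rule ccontr)
      assume "\<not> ?thesis"
      then have "card (colour_set U c1 i) < q" using c1(3)[OF that] by simp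
      then have "(\<Sum>i\<in>{1..k}. card (colour_set U c1 i)) < (\<Sum>i\<in>{1..k}. q)"
        using that c1(3) by (intro sum_strict_mono_ex1) auto
      then show False using card_tree_colouring[OF c1(1) order.trans[OF U(1) less.prems]] cardU by simp
    qed
    show ?thesis
    proof (cases "r = 0")
      case True
      then have "U = W" using U R finR by auto
      have "card W div k = q" "(card W + k - 1) div k = q"
        using W True k div_up by auto
      then show ?thesis
        using c1(1) U_card unfolding \<open>U = W\<close> by auto
    next
      case False
      have "\<exists>c2. tree_colouring k (U \<union> R) c2 \<and> (\<forall>u\<in>H. c2 u = c1 u) \<and>
        (\<forall>i\<in>{1..k}. card (colour_set U c1 i) \<le> card (colour_set (U \<union> R) c2 i) \<and>
          card (colour_set (U \<union> R) c2 i) \<le> q + 1)"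
      proof (rule extend_colouring_set[OF d degree less.prems U(2) order.refl H(1) _ _ _ t2 c1(1) _ finR _ U(3)])
        show "h2 \<le> card (N u \<inter> W)" if "u \<in> H" for u
          using that H(3)[of u] finW unfolding h2_def deg_def
          by (subst Max_le_iff) auto
        show "card (colour_set H c1 i) = \<eta>" if "i \<in> {1..k}" for i
        proof -
          have "colour_set H c1 i = colour_set H c0 i" using c1(2) by (auto simp: colour_set_def)
          then show ?thesis using H_card[OF that] by simp
        qed
        show "card W + k * \<eta> \<le> k * (q + 1) + card H" using H W by simp
        show "card (colour_set U c1 i) \<le> q + 1" if "i \<in> {1..k}" for i
          using c1(3)[OF that] by simp
        show "U \<union> R \<subseteq> W" using U by simp
        show "card U + card R \<le> k * (q + 1)" using cardU R W by simp
        show "card (N u \<inter> W) \<le> h2" if "u \<in> U \<union> R - H" for u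
          using that finW U unfolding h2_def deg_def by (intro Max_ge) auto
      qed
      then obtain c2 where c2: "tree_colouring k W c2"
        "\<And>i. i \<in> {1..k} \<Longrightarrow> card (colour_set U c1 i) \<le> card (colour_set W c2 i)"
        "\<And>i. i \<in> {1..k} \<Longrightarrow> card (colour_set W c2 i) \<le> q + 1"
        unfolding U(4) by blast
      have "card W div k = q" by (simp add: q_def)
      moreover have "(card W + k - 1) div k = q + 1"
        using W False by (intro div_nat_eqI) auto
      ultimately show ?thesis
        using c2 U_card by (intro exI[of _ c2]) auto
    qed
  qed
qed

end

section \<open>Transfer to digraphs\<close>

definition neighbours :: "('a, 'b) pre_digraph \<Rightarrow> 'a \<Rightarrow> 'a set" where
  "neighbours G v = {w. v \<rightarrow>\<^bsub>G\<^esub> w}"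

lemma (in wf_digraph) neighbours_subset_verts: "neighbours G v \<subseteq> verts G"
  by (auto simp: neighbours_def)

lemma (in digraph) irrefl_neighbours: "v \<notin> neighbours G v"
  by (auto simp: neighbours_def arcs_ends_conv dest: no_loops)

lemma (in sym_digraph) sym_neighbours: "u \<in> neighbours G v \<longleftrightarrow> v \<in> neighbours G u"
  using sym_arcs by (auto simp: neighbours_def symmetric_def dest: symD)

lemma (in graph) card_neighbours_le:
  assumes "max_degree G \<le> \<Delta>"
  shows "card (neighbours G v) \<le> \<Delta>"
proof (cases "v \<in> verts G")
  case True
  then have "out_degree G v \<le> max_degree G"
    unfolding max_degree_def by (intro Max_ge) auto
  then show ?thesis
    using assms by (simp add: neighbours_def out_degree_eq_card_neighbours)
next
  case False
  then have "neighbours G v = {}"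
    by (auto simp: neighbours_def)
  then show ?thesis by simp
qed

text \<open>The subgraph induced by \<open>S\<close> keeps both arcs of each edge, so it is a graph
  to which degeneracy applies.\<close>

lemma (in graph) degenerateD:
  assumes "degenerate d G" "S \<subseteq> verts G" "S \<noteq> {}"
  shows "\<exists>v\<in>S. card (neighbours G v \<inter> S) \<le> d"
proof -
  have ind: "induced_subgraph (G \<restriction> S) G"
    using assms(2) by (rule induced_induce)
  interpret S: digraph "G \<restriction> S" using ind by (rule digraphI_induced)
  interpret S: graph "G \<restriction> S"
    by (rule S.graphI[OF induced_graph_imp_symmetric[OF sym_arcs ind]])
  have "subgraph (G \<restriction> S) G \<and> graph (G \<restriction> S) \<and> verts (G \<restriction> S) \<noteq> {}"
    using induced_imp_subgraph[OF ind] S.graph_axioms assms(3) by simp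
  then have "\<exists>v\<in>verts (G \<restriction> S). out_degree (G \<restriction> S) v \<le> d"
    using assms(1) unfolding degenerate_def by blast
  then obtain v where v: "v \<in> S" "out_degree (G \<restriction> S) v \<le> d"
    by auto
  have "{w. v \<rightarrow>\<^bsub>G \<restriction> S\<^esub> w} = neighbours G v \<inter> S"
    using v(1) by (auto simp: neighbours_def arcs_ends_conv)
  then show ?thesis
    using v S.out_degree_eq_card_neighbours[of v] by auto
qed

text \<open>Every vertex of a cycle has two neighbours on the cycle.\<close>

lemma (in graph) acyclic_graph_induceI:
  assumes forest: "\<And>T. T \<subseteq> S \<Longrightarrow> T \<noteq> {} \<Longrightarrow> \<exists>v\<in>T. card (neighbours G v \<inter> T) \<le> 1"
  shows "acyclic_graph (G \<restriction> S)"
  unfolding acyclic_graph_def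
proof
  assume "\<exists>p. pre_digraph.cycle (G \<restriction> S) p \<and> 3 \<le> length p"
  then obtain p u where u: "pre_digraph.awalk (G \<restriction> S) u p u"
    and dist: "distinct (tl (pre_digraph.awalk_verts (G \<restriction> S) u p))" and len: "3 \<le> length p"
    unfolding pre_digraph.cycle_def by blast
  interpret S: wf_digraph "G \<restriction> S" by (rule wellformed_induce_subgraph)
  define n where "n = length p"
  \<comment> \<open>\<open>f i\<close> is the head of the \<open>i\<close>-th arc. The start of the
    closed walk is the head of the last arc, so \<open>T\<close> contains all its vertices.\<close>
  define f where "f i = head G (p ! i)" for i
  define T where "T = f ` {..<n}"
  have cas: "S.cas u p u" and arcs: "set p \<subseteq> arcs (G \<restriction> S)"
    using u by (auto simp: S.awalk_def)
  have nth: "(\<forall>i<length q. tail G (q ! i) = (w # map (head G) q) ! i)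
      \<and> z = (w # map (head G) q) ! length q" if "S.cas w q z" for w q z
    using that by (induction q arbitrary: w) (auto simp: nth_Cons split: nat.splits)
  have inj: "inj_on f {..<n}"
  proof -
    have "distinct (map (head G) p)"
      using dist len by (auto simp: S.awalk_verts_conv'[OF cas] split: if_splits)
    then show ?thesis
      by (auto simp: inj_on_def f_def n_def distinct_conv_nth)
  qed
  \<comment> \<open>The arc \<open>p ! j\<close> runs from \<open>f i\<close> to \<open>f j\<close>;
    for \<open>j = 0\<close> its tail is \<open>u\<close>, where the last arc ends.\<close>
  have adj: "f j \<in> neighbours G (f i)" if "i < n" "j < n" "j = Suc i \<or> j = 0 \<and> Suc i = n" for i j
  proof -
    have "tail G (p ! j) = (u # map (head G) p) ! j" "u = (u # map (head G) p) ! n"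
      using nth[OF cas] that by (auto simp: n_def)
    then have "tail G (p ! j) = f i"
      using that by (auto simp: f_def n_def nth_Cons split: nat.splits)
    moreover have "p ! j \<in> arcs G"
      using subsetD[OF arcs nth_mem[of j p]] that by (simp add: n_def)
    ultimately show ?thesis
      by (force simp: neighbours_def arcs_ends_conv f_def)
  qed
  have "T \<subseteq> S" using subsetD[OF arcs nth_mem] by (auto simp: T_def f_def n_def)
  moreover have "T \<noteq> {}" using len by (auto simp: T_def n_def lessThan_empty_iff)
  ultimately have "\<exists>v\<in>T. card (neighbours G v \<inter> T) \<le> 1"
    by (rule forest)
  then obtain v where "v \<in> T" and v: "card (neighbours G v \<inter> T) \<le> 1" ..
  from this(1) obtain i where i: "i < n" "v = f i" by (auto simp: T_def)
  \<comment> \<open>The cyclic successor and predecessor of \<open>i\<close>, distinct because the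
    cycle has at least three arcs.\<close>
  define i' where "i' = (if Suc i = n then 0 else Suc i)"
  define i'' where "i'' = (if i = 0 then n - 1 else i - 1)"
  have bounds: "i' < n" "i'' < n" "i' \<noteq> i''"
    using i len by (auto simp: i'_def i''_def n_def)
  have "f i' \<in> neighbours G v"
    unfolding i(2) using i(1) bounds by (intro adj) (auto simp: i'_def)
  moreover have "v \<in> neighbours G (f i'')"
    unfolding i(2) using i(1) bounds by (intro adj) (auto simp: i''_def split: if_splits)
  ultimately have "{f i', f i''} \<subseteq> neighbours G v \<inter> T"
    using sym_neighbours[of "f i''" v] bounds by (auto simp: T_def)
  moreover have "f i' \<noteq> f i''"
    using inj bounds by (auto dest: inj_onD)
  moreover have "finite (neighbours G v \<inter> T)"
    by (simp add: T_def)
  ultimately have "2 \<le> card (neighbours G v \<inter> T)"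
    using card_mono[of "neighbours G v \<inter> T" "{f i', f i''}"] by simp
  then show False using v by simp
qed

theorem theorem2:
  fixes G :: "('a, 'b) pre_digraph" and d \<Delta> k :: nat
  assumes "1 \<le> d"
    and "10 * d \<le> \<Delta>"
    and "graph G"
    and "degenerate d G"
    and "max_degree G \<le> \<Delta>"
    and "(real \<Delta> + 1) / 2 \<le> real k"
  shows "equitably_tree_colourable G k"
proof -
  interpret graph G by fact
  interpret sparse_graph "verts G" "neighbours G" d
  proof
    show "finite (verts G)" by simp
    show "neighbours G v \<subseteq> verts G" for v by (rule neighbours_subset_verts)
    show "v \<notin> neighbours G v" for v by (rule irrefl_neighbours)
    show "v \<in> neighbours G u" if "u \<in> neighbours G v" for u v
      using that sym_neighbours by blast
    show "\<exists>v\<in>S. card (neighbours G v \<inter> S) \<le> d" if "S \<subseteq> verts G" "S \<noteq> {}" for S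
      using degenerateD[OF assms(4) that] .
  qed
  \<comment> \<open>Together with \<open>10 * d \<le> \<Delta>\<close> this yields
    \<open>5 * d \<le> k\<close>, and it bounds all degrees by \<open>2 * k\<close>.\<close>
  have k: "\<Delta> + 1 \<le> 2 * k"
    using assms(6) by (simp add: field_simps)
  have "card (neighbours G u) \<le> 2 * k" for u
    using card_neighbours_le[OF assms(5), of u] k by simp
  then obtain c where c: "tree_colouring k (verts G) c"
    and size: "\<And>i. i \<in> {1..k} \<Longrightarrow> card (verts G) div k \<le> card (colour_set (verts G) c i)"
    "\<And>i. i \<in> {1..k} \<Longrightarrow> card (colour_set (verts G) c i) \<le> (card (verts G) + k - 1) div k"
    using equitable_tree_colouring_exists[of k "verts G"] assms(1,2) k by fastforce
  have class_eq: "colour_class G c i = colour_set (verts G) c i" for i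
    by (simp add: colour_class_def colour_set_def)
  have "(card (verts G) + k - 1) div k \<le> card (verts G) div k + 1"
  proof -
    have "(card (verts G) + k - 1) div k \<le> (card (verts G) + k) div k" by (intro div_le_mono) simp
    then show ?thesis using k by simp
  qed
  then have "\<bar>int (card (colour_class G c i)) - int (card (colour_class G c j))\<bar> \<le> 1"
    if "i \<in> {1..k}" "j \<in> {1..k}" for i j
    using size[OF that(1)] size[OF that(2)] unfolding class_eq by linarith
  moreover have "acyclic_graph (G \<restriction> colour_class G c i)" for i
    unfolding class_eq using c
    by (intro acyclic_graph_induceI) (auto simp: tree_colouring_def induces_forest_def colour_set_def)
  ultimately have "equitable_tree_colouring G k c"
    using c unfolding equitable_tree_colouring_def tree_colouring_def by simp
  then show ?thesis unfolding equitably_tree_colourable_def by blast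
qed

end
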